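(* Let $X\neq\{0\}$ be a complex Banach space with open unit ball $\mathbb{B}$, and let $F:\mathbb{B}\to X$ be a biholomorphic mapping given by $F(x)=f(x)x$, $x\in\mathbb{B}$, where $f:\mathbb{B}\to\mathbb{C}$ is holomorphic with $f(0)=1$. Then $F(\mathbb{B})$ contains the ball $B_{1/4}=\{x\in X:\|x\|<1/4\}$. The constant $1/4$ is the best possible: for every $c>1/4$ there is a mapping $F$ satisfying these hypotheses such that $F(\mathbb{B})$ does not contain $\{x\in X:\|x\|<c\}$.
   Context: A holomorphic mapping $F$ on $\mathbb{B}$ is biholomorphic on $\mathbb{B}$ if it is injective, $F(\mathbb{B})$ is open, and the inverse $F(\mathbb{B})\to\mathbb{B}$ is holomorphic. *)

theory Defs
  imports "HOL-Complex_Analysis.Complex_Analysis"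
begin

text \<open>The real scalar multiplication of the underlying real normed space is required to be
  the restriction of the complex one.\<close>

class complex_normed_vector = real_normed_vector +
  fixes scaleC :: "complex \<Rightarrow> 'a \<Rightarrow> 'a" (infixr \<open>*\<^sub>C\<close> 75)
  assumes scaleC_add_right: "a *\<^sub>C (x + y) = a *\<^sub>C x + a *\<^sub>C y"
    and scaleC_add_left: "(a + b) *\<^sub>C x = a *\<^sub>C x + b *\<^sub>C x"
    and scaleC_scaleC: "a *\<^sub>C (b *\<^sub>C x) = (a * b) *\<^sub>C x"
    and scaleC_one: "1 *\<^sub>C x = x"
    and scaleC_of_real: "complex_of_real r *\<^sub>C x = r *\<^sub>R x"
    and norm_scaleC: "norm (a *\<^sub>C x) = cmod a * norm x"

class complex_banach = complex_normed_vector + banach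

instantiation complex :: complex_banach
begin

definition scaleC_complex_def: "a *\<^sub>C (x::complex) = a * x"

instance
  by standard (auto simp: scaleC_complex_def algebra_simps norm_mult scaleR_conv_of_real)

end

text \<open>Holomorphy between complex normed spaces is complex Frechet differentiability at every
  point of an open set. The library predicate \<^term>\<open>(f has_derivative D) (at x)\<close> already
  makes \<^term>\<open>D\<close> bounded and real-linear, so only complex homogeneity is added.\<close>

definition holomorphic_map_on ::
    "('a::complex_normed_vector \<Rightarrow> 'b::complex_normed_vector) \<Rightarrow> 'a set \<Rightarrow> bool" where
  "holomorphic_map_on f S \<longleftrightarrow> open S \<and>
     (\<forall>x\<in>S. \<exists>D. (f has_derivative D) (at x) \<and> (\<forall>a y. D (a *\<^sub>C y) = a *\<^sub>C D y))"

definition biholomorphic_on ::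
    "('a::complex_normed_vector \<Rightarrow> 'b::complex_normed_vector) \<Rightarrow> 'a set \<Rightarrow> bool" where
  "biholomorphic_on F S \<longleftrightarrow> holomorphic_map_on F S \<and> inj_on F S \<and> open (F ` S) \<and>
     holomorphic_map_on (inv_into S F) (F ` S)"

lemma holomorphic_map_on_complex_iff:
  fixes f :: "complex \<Rightarrow> complex"
  assumes "open S"
  shows "holomorphic_map_on f S \<longleftrightarrow> f holomorphic_on S"
proof -
  have "(\<exists>D. (f has_derivative D) (at x) \<and> (\<forall>a y. D (a *\<^sub>C y) = a *\<^sub>C D y))
      \<longleftrightarrow> f field_differentiable at x" for x
  proof
    assume "\<exists>D. (f has_derivative D) (at x) \<and> (\<forall>a y. D (a *\<^sub>C y) = a *\<^sub>C D y)"
    then obtain D where D: "(f has_derivative D) (at x)" "\<And>a y. D (a * y) = a * D y"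
      by (auto simp: scaleC_complex_def)
    have "D = (*) (D 1)"
    proof
      fix a show "D a = D 1 * a"
        using D(2)[of a 1] by (simp only: mult_1_right mult.commute[of a])
    qed
    from subst[OF this, of "\<lambda>E. (f has_derivative E) (at x)"] D(1)
    have "(f has_derivative (*) (D 1)) (at x)" by blast
    then show "f field_differentiable at x"
      unfolding field_differentiable_def has_field_derivative_def by blast
  next
    assume "f field_differentiable at x"
    then obtain d where "(f has_derivative (*) d) (at x)"
      unfolding field_differentiable_def has_field_derivative_def by blast
    then show "\<exists>D. (f has_derivative D) (at x) \<and> (\<forall>a y. D (a *\<^sub>C y) = a *\<^sub>C D y)"
      by (intro exI[of _ "(*) d"]) (auto simp: scaleC_complex_def)
  qed
  then show ?thesis
    using assms by (simp add: holomorphic_map_on_def holomorphic_on_def at_within_open[OF _ assms])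
qed

end

theory Submission
  imports Defs
begin

text \<open>On the complex line through a unit vector \<open>u\<close> the map acts as the univalent function
  \<open>g z = f (z u) z\<close> with \<open>g 0 = 0\<close> and \<open>g' 0 = 1\<close>, so the covering statement is Koebe's one-quarter theorem.
  If \<open>g\<close> omits \<open>w\<close>, let \<open>s\<close> be the square root of \<open>1 - g/w\<close> with \<open>s 0 = 1\<close>; then \<open>h = (1 - s)/(1 + s)\<close> is
  univalent, never satisfies \<open>h z * h z' = 1\<close>, and \<open>h' 0 = 1/(4w)\<close>. Such an \<open>h\<close> has \<open>|h' 0| \<le> 1\<close>:
  in logarithmic coordinates it becomes an injective map \<open>\<phi> z = z + \<kappa> z\<close> of the left half plane for which
  \<open>\<phi>\<close> and \<open>- \<phi>\<close> have disjoint images, and if \<open>|h' 0| > 1\<close> the images of a long rectangle under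
  \<open>\<phi>\<close> and \<open>- \<phi>\<close> would have more area than a box containing both.

  For sharpness, a norm-one complex functional \<open>l\<close> with \<open>l u = 1\<close> (Hahn--Banach) turns the Koebe function
  into \<open>F x = x / (1 - l x)^2\<close>, which omits \<open>- u/4\<close>.\<close>

section \<open>Area of holomorphic images\<close>

no_notation fps_nth (infixl \<open>$\<close> 75)


text \<open>The change of variables theorem of the library is stated for \<open>real^2\<close>, so areas are measured there.\<close>

definition vec2 :: "complex \<Rightarrow> real^2" where
  "vec2 z = vector [Re z, Im z]"

definition cpx :: "real^2 \<Rightarrow> complex" where
  "cpx v = Complex (v$1) (v$2)"

lemma vec2_nth [simp]: "vec2 z $ 1 = Re z" "vec2 z $ 2 = Im z"
  by (simp_all add: vec2_def)

lemma cpx_sel [simp]: "Re (cpx v) = v$1" "Im (cpx v) = v$2"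
  by (simp_all add: cpx_def)

lemma vec2_cpx [simp]: "vec2 (cpx v) = v"
  by (simp add: vec_eq_iff forall_2)

lemma cpx_vec2 [simp]: "cpx (vec2 z) = z"
  by (simp add: complex_eq_iff)

lemma vec2_eq_iff [simp]: "vec2 z = vec2 w \<longleftrightarrow> z = w"
  by (metis cpx_vec2)

lemma cpx_eq_iff [simp]: "cpx u = cpx v \<longleftrightarrow> u = v"
  by (metis vec2_cpx)

lemma bounded_linear_vec2: "bounded_linear vec2"
  by (intro linear_conv_bounded_linear[THEN iffD1] linearI) (auto simp: vec_eq_iff forall_2)

lemma bounded_linear_cpx: "bounded_linear cpx"
  by (intro linear_conv_bounded_linear[THEN iffD1] linearI) (auto simp: complex_eq_iff)

lemma cpx_image_cbox: "cpx ` cbox u v = cbox (cpx u) (cpx v)"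
proof -
  have "z \<in> cpx ` cbox u v" if "z \<in> cbox (cpx u) (cpx v)" for z
    using that by (intro image_eqI[of _ _ "vec2 z"]) (auto simp: mem_box_cart forall_2 in_cbox_complex_iff)
  then show ?thesis
    by (auto simp: mem_box_cart forall_2 in_cbox_complex_iff)
qed

lemma content_cbox_vec2:
  assumes "Re p \<le> Re q" "Im p \<le> Im q"
  shows "measure lebesgue (cbox (vec2 p) (vec2 q)) = (Re q - Re p) * (Im q - Im p)"
proof -
  have "cbox (vec2 p) (vec2 q) \<noteq> {}"
    using assms by (auto simp: interval_ne_empty_cart forall_2)
  then show ?thesis
    by (simp add: content_cbox_cart UNIV_2)
qed

section \<open>Integration over plane boxes and the area formula\<close>

text \<open>Fubini is available on \<open>real \<times> real\<close>. The coordinate map to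
  \<open>real^2\<close> sends boxes to boxes of equal area, so the integral is transferred with
  scaling factor 1.\<close>

lemma integral_vec2_eq_iterated:
  fixes g :: "complex \<Rightarrow> real"
  assumes "continuous_on (cbox (Complex a c) (Complex b d)) g"
  shows "((\<lambda>v. g (cpx v)) has_integral integral {a..b} (\<lambda>x. integral {c..d} (\<lambda>y. g (Complex x y))))
           (cbox (vec2 (Complex a c)) (vec2 (Complex b d)))"
proof -
  let ?G = "\<lambda>v::real^2. (v$1, v$2)" and ?H = "\<lambda>p::real \<times> real. vec2 (Complex (fst p) (snd p))"
  let ?f = "\<lambda>p. g (Complex (fst p) (snd p))"
  have cont: "continuous_on (cbox (a,c) (b,d)) ?f"
  proof (rule continuous_on_compose2[OF assms])
    show "continuous_on (cbox (a,c) (b,d)) (\<lambda>p. Complex (fst p) (snd p))"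
      unfolding Complex_eq by (intro continuous_intros)
  qed (auto simp: in_cbox_complex_iff cbox_Pair_eq)
  have G: "?G ` cbox u v = cbox (u$1,u$2) (v$1,v$2)" for u v
  proof -
    have "p \<in> ?G ` cbox u v" if "p \<in> cbox (u$1,u$2) (v$1,v$2)" for p
      using that by (intro image_eqI[of _ _ "?H p"]) (auto simp: mem_box_cart forall_2 cbox_Pair_eq)
    then show ?thesis by (auto simp: mem_box_cart forall_2 cbox_Pair_eq)
  qed
  have H: "?H ` cbox (u1,u2) (v1,v2) = cbox (vec2 (Complex u1 u2)) (vec2 (Complex v1 v2))" for u1 u2 v1 v2
  proof -
    have "p \<in> ?H ` cbox (u1,u2) (v1,v2)" if "p \<in> cbox (vec2 (Complex u1 u2)) (vec2 (Complex v1 v2))" for p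
      using that by (intro image_eqI[of _ _ "?G p"]) (auto simp: mem_box_cart forall_2 cbox_Pair_eq vec_eq_iff)
    then show ?thesis by (auto simp: mem_box_cart forall_2 cbox_Pair_eq)
  qed
  have "((\<lambda>x. ?f (?G x)) has_integral (1 / 1) *\<^sub>R integral (cbox (a,c) (b,d)) ?f) (?H ` cbox (a,c) (b,d))"
  proof (rule has_integral_twiddle)
    show "\<exists>w z. ?H ` cbox u v = cbox w z" for u v
      using H[of "fst u" "snd u" "fst v" "snd v"] by auto
    show "measure lborel (?G ` cbox u v) = 1 * measure lborel (cbox u v)" for u v
    proof (cases "cbox u v = {}")
      case False
      then have "u$1 \<le> v$1" "u$2 \<le> v$2"
        by (auto simp: interval_ne_empty_cart forall_2)
      then show ?thesis
        unfolding G content_Pair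
        using content_cbox_vec2[of "cpx u" "cpx v"] by simp
    qed auto
    show "\<exists>w z. ?G ` cbox u v = cbox w z" for u v
      using G by blast
    show "continuous (at v) ?G" for v
      by (intro continuous_intros)
    show "(?f has_integral integral (cbox (a,c) (b,d)) ?f) (cbox (a,c) (b,d))"
      by (intro integrable_integral integrable_continuous cont)
  qed (simp_all add: vec_eq_iff forall_2)
  then show ?thesis
    by (simp add: H integral_prod_continuous[OF cont] cpx_def)
qed

text \<open>By the Cauchy-Riemann form of the matrix, the Jacobian of a holomorphic map is the
  squared modulus of its derivative.\<close>

lemma det_matrix_complex_mult: "det (matrix (vec2 \<circ> (*) w \<circ> cpx)) = (cmod w)\<^sup>2"
  by (simp add: det_2 matrix_def axis_def cmod_power2) (simp add: power2_eq_square)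

text \<open>Change of variables for \<open>f\<close> read in real coordinates. The density is
  continuous on the compact box, so its integral exists and equals the area of the image.\<close>

lemma area_holomorphic_image:
  assumes "f holomorphic_on U" "open U" "cbox p q \<subseteq> U" "inj_on f (cbox p q)"
  shows "vec2 ` f ` cbox p q \<in> lmeasurable \<and>
     ((\<lambda>v. (cmod (deriv f (cpx v)))\<^sup>2) has_integral measure lebesgue (vec2 ` f ` cbox p q))
        (cbox (vec2 p) (vec2 q))"
proof -
  let ?S = "cbox (vec2 p) (vec2 q)" and ?f = "vec2 \<circ> f \<circ> cpx"
  let ?f' = "\<lambda>v. vec2 \<circ> (*) (deriv f (cpx v)) \<circ> cpx"
  have cpxS: "cpx ` ?S = cbox p q"
    by (simp add: cpx_image_cbox)
  have im: "?f ` ?S = vec2 ` f ` cbox p q"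
    by (simp add: image_comp flip: cpxS)
  have d: "(?f has_derivative ?f' v) (at v within ?S)" if "v \<in> ?S" for v
  proof -
    have "cpx v \<in> U" using that cpxS assms(3) by blast
    then have "(f has_derivative (*) (deriv f (cpx v))) (at (cpx v))"
      using assms(1,2) holomorphic_derivI by (simp add: has_field_derivative_def)
    then have "(f \<circ> cpx has_derivative (*) (deriv f (cpx v)) \<circ> cpx) (at v)"
      by (rule diff_chain_at[OF bounded_linear_imp_has_derivative[OF bounded_linear_cpx]])
    then have "(vec2 \<circ> (f \<circ> cpx) has_derivative vec2 \<circ> ((*) (deriv f (cpx v)) \<circ> cpx)) (at v)"
      by (rule diff_chain_at) (rule bounded_linear_imp_has_derivative[OF bounded_linear_vec2])
    then show ?thesis
      by (simp add: has_derivative_at_withinI comp_assoc)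
  qed
  have inj: "inj_on ?f ?S"
  proof (rule inj_onI)
    fix u v assume "u \<in> ?S" "v \<in> ?S" "?f u = ?f v"
    then have "cpx u \<in> cbox p q" "cpx v \<in> cbox p q" "f (cpx u) = f (cpx v)"
      using cpxS by auto
    then show "u = v"
      using assms(4) by (meson cpx_eq_iff inj_onD)
  qed
  have "continuous_on (cbox p q) (deriv f)"
    using holomorphic_deriv[OF assms(1,2)] assms(3)
    by (meson continuous_on_subset holomorphic_on_imp_continuous_on)
  then have "continuous_on ?S (\<lambda>v. (cmod (deriv f (cpx v)))\<^sup>2)"
    using continuous_on_compose2[OF _ linear_continuous_on[OF bounded_linear_cpx], of "cbox p q" "deriv f" ?S] cpxS
    by (intro continuous_intros) auto
  then have "(\<lambda>v. (cmod (deriv f (cpx v)))\<^sup>2) integrable_on ?S"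
    by (rule integrable_continuous)
  then obtain m where m: "((\<lambda>v. (cmod (deriv f (cpx v)))\<^sup>2) has_integral m) ?S"
    by blast
  have "?f ` ?S \<in> lmeasurable \<and> measure lebesgue (?f ` ?S) = m"
    by (subst has_measure_differentiable_image[OF _ d inj])
       (use m in \<open>auto simp: det_matrix_complex_mult\<close>)
  with m im show ?thesis by auto
qed

text \<open>The area density is at least \<open>1 + 2 * Re (deriv k z)\<close>, and on vertical
  lines \<open>Re (deriv k z)\<close> is the \<open>y\<close>-derivative of \<open>Im (k z)\<close>.
  Each vertical integral is thus \<open>2 * Y\<close> plus boundary terms of total size at most
  \<open>4 * M\<close>, an error that does not grow with the height of the box.\<close>

lemma area_near_identity_ge:
  assumes hol: "k holomorphic_on U" "open U" and Q: "cbox (Complex a (-Y)) (Complex b Y) \<subseteq> U"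
    and "a \<le> b" "0 \<le> Y"
    and inj: "inj_on (\<lambda>z. z + k z) (cbox (Complex a (-Y)) (Complex b Y))"
    and M: "\<And>z. z \<in> cbox (Complex a (-Y)) (Complex b Y) \<Longrightarrow> cmod (k z) \<le> M"
  defines "S \<equiv> vec2 ` (\<lambda>z. z + k z) ` cbox (Complex a (-Y)) (Complex b Y)"
  shows "S \<in> lmeasurable" "measure lebesgue S \<ge> (b - a) * (2 * Y - 4 * M)"
proof -
  let ?Q = "cbox (Complex a (-Y)) (Complex b Y)" and ?f = "\<lambda>z. z + k z"
  have holf: "?f holomorphic_on U" using hol by (intro holomorphic_intros)
  note area = area_holomorphic_image[OF holf hol(2) Q inj, folded S_def]
  show "S \<in> lmeasurable" using area by blast
  have derk: "(k has_field_derivative deriv k z) (at z)" if "z \<in> ?Q" for z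
    using that hol Q by (meson holomorphic_derivI subsetD)
  have derf: "deriv ?f z = 1 + deriv k z" if "z \<in> ?Q" for z
    using derk[OF that] by (intro DERIV_imp_deriv) (auto intro!: derivative_eq_intros)
  have cont: "continuous_on ?Q (deriv k)"
    using holomorphic_deriv[OF hol] Q by (meson continuous_on_subset holomorphic_on_imp_continuous_on)
  have contk: "continuous_on ?Q k"
    using hol Q by (meson continuous_on_subset holomorphic_on_imp_continuous_on)
  let ?g = "\<lambda>z. 1 + 2 * Re (deriv k z)"
  have contg: "continuous_on ?Q ?g" by (intro continuous_intros cont)
  \<comment> \<open>The integral of the lower density over the vertical segment at abscissa
    \<open>x\<close>.\<close>
  define I where "I x = integral {-Y..Y} (\<lambda>y. ?g (Complex x y))" for x
  have I_eq: "I x = 2 * Y + 2 * (Im (k (Complex x Y)) - Im (k (Complex x (-Y))))" if x: "x \<in> {a..b}" for x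
  proof -
    have "((\<lambda>y. ?g (Complex x y)) has_integral
            (Y + 2 * Im (k (Complex x Y))) - (-Y + 2 * Im (k (Complex x (-Y))))) {-Y..Y}"
    proof (rule fundamental_theorem_of_calculus)
      fix y assume y: "y \<in> {-Y..Y}"
      have z: "Complex x y \<in> ?Q" using x y by (auto simp: in_cbox_complex_iff)
      have "((\<lambda>y. Complex x y) has_vector_derivative \<i>) (at y within {-Y..Y})"
        unfolding Complex_eq by (auto intro!: derivative_eq_intros)
      from field_vector_diff_chain_within[OF this has_field_derivative_at_within[OF derk[OF z]]]
      have "((\<lambda>y. k (Complex x y)) has_vector_derivative (\<i> * deriv k (Complex x y))) (at y within {-Y..Y})"
        by (simp add: o_def)
      from bounded_linear.has_vector_derivative[OF bounded_linear_Im this]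
      have "((\<lambda>y. Im (k (Complex x y))) has_real_derivative Re (deriv k (Complex x y))) (at y within {-Y..Y})"
        by (simp add: has_real_derivative_iff_has_vector_derivative)
      from DERIV_add[OF DERIV_ident DERIV_cmult[OF this, of 2]] show "((\<lambda>y. y + 2 * Im (k (Complex x y))) has_vector_derivative ?g (Complex x y)) (at y within {-Y..Y})"
        by (simp add: has_real_derivative_iff_has_vector_derivative)
    qed (use assms in auto)
    then show ?thesis unfolding I_def by (simp add: integral_unique)
  qed
  have "2 * Y - 4 * M \<le> I x" if x: "x \<in> {a..b}" for x
  proof -
    have "Complex x Y \<in> ?Q" "Complex x (-Y) \<in> ?Q"
      using x \<open>0 \<le> Y\<close> by (auto simp: in_cbox_complex_iff)
    from this[THEN M] have "\<bar>Im (k (Complex x Y))\<bar> \<le> M" "\<bar>Im (k (Complex x (-Y)))\<bar> \<le> M"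
      using abs_Im_le_cmod order_trans by blast+
    then show ?thesis
      by (simp add: I_eq[OF x] abs_le_iff)
  qed
  moreover have "continuous_on {a..b} (\<lambda>x. 2 * Y + 2 * (Im (k (Complex x Y)) - Im (k (Complex x (-Y)))))"
    by (intro continuous_intros continuous_on_compose2[OF contk])
       (use \<open>0 \<le> Y\<close> in \<open>auto simp: in_cbox_complex_iff Complex_eq intro!: continuous_intros\<close>)
  then have "(\<lambda>x. I x) integrable_on {a..b}"
    using I_eq by (subst integrable_cong[where g="\<lambda>x. 2 * Y + 2 * (Im (k (Complex x Y)) - Im (k (Complex x (-Y))))"])
      (auto intro: integrable_continuous_interval)
  ultimately have "integral {a..b} (\<lambda>x. 2 * Y - 4 * M) \<le> integral {a..b} I"
    by (intro integral_le) auto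
  then have "(b - a) * (2 * Y - 4 * M) \<le> integral {a..b} I"
    using \<open>a \<le> b\<close> by simp
  also have "integral {a..b} I \<le> measure lebesgue S"
  proof (rule has_integral_le)
    show "((\<lambda>v. ?g (cpx v)) has_integral integral {a..b} I) (cbox (vec2 (Complex a (-Y))) (vec2 (Complex b Y)))"
      using integral_vec2_eq_iterated[OF contg] by (simp add: I_def[abs_def])
    fix v assume "v \<in> cbox (vec2 (Complex a (-Y))) (vec2 (Complex b Y))"
    then have v: "cpx v \<in> ?Q" by (metis cpx_image_cbox cpx_vec2 image_eqI)
    txt \<open>This linear lower bound of the area density is a divergence, so its integral only sees the boundary.\<close>
    have "1 + 2 * Re w \<le> (cmod (1 + w))\<^sup>2" for w
      unfolding cmod_power2 by (simp add: power2_eq_square algebra_simps)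
    then show "?g (cpx v) \<le> (cmod (deriv ?f (cpx v)))\<^sup>2"
      by (simp add: derf[OF v])
  qed (use area in blast)
  finally show "measure lebesgue S \<ge> (b - a) * (2 * Y - 4 * M)" .
qed

section \<open>The Koebe one-quarter theorem\<close>

lemma lmeasurable_uminus_image:
  fixes S :: "(real^2) set"
  assumes "S \<in> lmeasurable"
  shows "uminus ` S \<in> lmeasurable" "measure lebesgue (uminus ` S) = measure lebesgue S"
proof -
  have lin: "linear (uminus :: real^2 \<Rightarrow> real^2)"
    by (intro linearI) auto
  show "uminus ` S \<in> lmeasurable"
    using measurable_linear_image[OF lin assms] .
  have "det (matrix (uminus :: real^2 \<Rightarrow> real^2)) = 1"
    by (simp add: det_2 matrix_def axis_def)
  then show "measure lebesgue (uminus ` S) = measure lebesgue S"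
    using measure_linear_image[OF lin assms] by simp
qed

text \<open>A univalent form of the Bieberbach--Eilenberg inequality.\<close>

lemma univalent_product_ne_1_deriv_le_1:
  assumes holh: "h holomorphic_on ball 0 1" and inj: "inj_on h (ball 0 1)" and "h 0 = 0"
    and ne1: "\<And>z w. z \<in> ball 0 1 \<Longrightarrow> w \<in> ball 0 1 \<Longrightarrow> h z * h w \<noteq> 1"
  shows "cmod (deriv h 0) \<le> 1"
proof (rule ccontr)
  assume gt1: "\<not> cmod (deriv h 0) \<le> 1"
  \<comment> \<open>This is \<open>h z / z\<close> with the singularity at 0 removed. Injectivity of
    \<open>h\<close> makes it zero-free, so it has a logarithm \<open>k\<close> and
    \<open>h z = z * exp (k z)\<close>.\<close>
  define q where "q = (\<lambda>z. if z = 0 then deriv h 0 else (h z - h 0) / (z - 0))"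
  have holq: "q holomorphic_on ball 0 1"
    unfolding q_def by (rule pole_lemma[OF holh]) simp
  have hq: "h z = z * q z" for z
    using \<open>h 0 = 0\<close> by (simp add: q_def)
  have "q z \<noteq> 0" if "z \<in> ball 0 1" for z
  proof (cases "z = 0")
    case True
    then show ?thesis using gt1 by (auto simp: q_def)
  next
    case False
    then have "h z \<noteq> h 0"
      using inj that by (metis centre_in_ball inj_onD zero_less_one)
    then show ?thesis using hq[of z] \<open>h 0 = 0\<close> by auto
  qed
  then obtain k where holk: "k holomorphic_on ball 0 1"
    and k: "\<And>z. z \<in> ball 0 1 \<Longrightarrow> q z = exp (k z)"
    using contractible_imp_holomorphic_log[OF holq convex_imp_contractible[OF convex_ball]] by blast
  \<comment> \<open>This is \<open>ln (cmod (deriv h 0))\<close>, positive by the assumption to be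
    refuted.\<close>
  define \<alpha> where "\<alpha> = Re (k 0)"
  have "\<alpha> > 0"
  proof -
    have "cmod (q 0) = exp \<alpha>" using k[of 0] by (simp add: \<alpha>_def)
    then show ?thesis using gt1 by (simp add: q_def)
  qed
  have contk: "continuous_on (ball 0 1) k"
    using holk by (rule holomorphic_on_imp_continuous_on)
  \<comment> \<open>The right edge of the rectangle. Its points have
    \<open>cmod (exp z) \<le> r < 1\<close>, so \<open>k\<close> is evaluated on a compact disc and
    is bounded there by some \<open>M\<close>.\<close>
  define b where "b = - \<alpha> / 4"
  define r where "r = exp b"
  have r: "0 < r" "r < 1" using \<open>\<alpha> > 0\<close> by (auto simp: r_def b_def)
  have "compact (k ` cball 0 r)"
    using r by (intro compact_continuous_image continuous_on_subset[OF contk]) auto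
  then obtain M where M0: "M > 0" and "\<And>w. w \<in> k ` cball 0 r \<Longrightarrow> cmod w \<le> M"
    by (meson bounded_pos compact_imp_bounded)
  then have M: "cmod (k z) \<le> M" if "cmod z \<le> r" for z using that by auto
  \<comment> \<open>Far to the left \<open>exp z\<close> is close to 0, so there
    \<open>z + k (exp z)\<close> is shifted to the right by at least
    \<open>3 * \<alpha> / 4\<close>.\<close>
  obtain \<rho> where "\<rho> > 0" and \<rho>: "\<And>z. cmod z < \<rho> \<Longrightarrow> 3 * \<alpha> / 4 \<le> Re (k z)"
  proof -
    have "isCont k 0" using contk by (simp add: continuous_on_eq_continuous_at)
    then obtain \<rho> where "\<rho> > 0" and "\<And>z. dist z 0 < \<rho> \<Longrightarrow> dist (k z) (k 0) < \<alpha> / 4"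
      using \<open>\<alpha> > 0\<close> unfolding continuous_at_eps_delta by (metis divide_pos_pos zero_less_numeral)
    then have "cmod (k z - k 0) < \<alpha> / 4" if "cmod z < \<rho>" for z
      using that by (simp add: dist_norm)
    then have "3 * \<alpha> / 4 \<le> Re (k z)" if "cmod z < \<rho>" for z
      using abs_Re_le_cmod[of "k z - k 0"] that by (fastforce simp: \<alpha>_def)
    with \<open>\<rho> > 0\<close> that show thesis by blast
  qed
  \<comment> \<open>With \<open>a\<close> this small, points with
    \<open>Re z \<ge> ln \<rho>\<close> stay to the right of \<open>- A\<close> even after a
    displacement of size \<open>M\<close>, and \<open>A \<ge> M\<close> keeps all image points to
    the left of \<open>A\<close>.\<close>
  define a where "a = min b (min (ln \<rho> - M - 3 * \<alpha> / 4) (- M - 3 * \<alpha> / 4))"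
  \<comment> \<open>Half the width of a box symmetric about 0 that contains the image. The rectangle
    has width \<open>b - a = A + \<alpha> / 2\<close>, and the surplus \<open>\<alpha> / 2\<close>
    gives the contradiction.\<close>
  define A where "A = - (a + 3 * \<alpha> / 4)"
  \<comment> \<open>The area comparison will give
    \<open>\<alpha> * Y \<le> 2 * (3 * A * M + \<alpha> * M)\<close>; this height violates it by
    exactly \<open>\<alpha>\<close>.\<close>
  define Y where "Y = (2 / \<alpha>) * (3 * A * M + \<alpha> * M) + 1"
  have a: "a \<le> b" "a \<le> ln \<rho> - M - 3 * \<alpha> / 4" "a \<le> - M - 3 * \<alpha> / 4"
    by (auto simp: a_def)
  have "A \<ge> M" using a by (simp add: A_def)
  then have "Y \<ge> 0" using M0 \<open>\<alpha> > 0\<close> by (simp add: Y_def)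
  define U where "U = {z. Re z < 0}"
  have expU: "exp z \<in> ball 0 1" if "z \<in> U" for z using that by (simp add: U_def)
  define \<kappa> where "\<kappa> = (\<lambda>z. k (exp z))"
  have hol\<kappa>: "\<kappa> holomorphic_on U"
    unfolding \<kappa>_def using holk expU
    by (intro holomorphic_on_compose_gen[of exp U k "ball 0 1", unfolded o_def] holomorphic_on_exp) auto
  have "open U" unfolding U_def by (rule open_halfspace_Re_lt)
  let ?Q = "cbox (Complex a (-Y)) (Complex b Y)" and ?f = "\<lambda>z. z + \<kappa> z"
  have QU: "?Q \<subseteq> U" using \<open>\<alpha> > 0\<close> by (auto simp: in_cbox_complex_iff U_def b_def)
  have exp_f: "exp (?f z) = h (exp z)" if "z \<in> U" for z
    using k[OF expU[OF that]] by (simp add: hq \<kappa>_def exp_add)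
  \<comment> \<open>The periodicity of \<open>exp\<close> does no harm: equal images force
    \<open>exp z = exp w\<close>, hence equal displacements, hence \<open>z = w\<close>.\<close>
  have inj_f: "inj_on ?f ?Q"
  proof (rule inj_onI)
    fix z w assume zw: "z \<in> ?Q" "w \<in> ?Q" "?f z = ?f w"
    then have U: "z \<in> U" "w \<in> U" using QU by auto
    have "h (exp z) = h (exp w)" using exp_f[OF U(1)] exp_f[OF U(2)] zw(3) by simp
    then have "exp z = exp w" using inj expU U by (meson inj_onD)
    then show "z = w" using zw(3) by (simp add: \<kappa>_def)
  qed
  have exp_Q: "cmod (exp z) \<le> r" if "z \<in> ?Q" for z
    using that by (simp add: r_def in_cbox_complex_iff)
  have M\<kappa>: "cmod (\<kappa> z) \<le> M" if "z \<in> ?Q" for z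
    unfolding \<kappa>_def using M exp_Q[OF that] by blast
  define S where "S = vec2 ` ?f ` ?Q"
  have S: "S \<in> lmeasurable" "measure lebesgue S \<ge> (b - a) * (2 * Y - 4 * M)"
    using area_near_identity_ge[OF hol\<kappa> \<open>open U\<close> QU a(1) \<open>Y \<ge> 0\<close> inj_f M\<kappa>] by (simp_all add: S_def)
  note T = lmeasurable_uminus_image[OF S(1)]
  have f_in: "\<bar>Re (?f z)\<bar> \<le> A \<and> \<bar>Im (?f z)\<bar> \<le> Y + M" if z: "z \<in> ?Q" for z
  proof -
    have z': "a \<le> Re z" "Re z \<le> b" "\<bar>Im z\<bar> \<le> Y" using z by (auto simp: in_cbox_complex_iff)
    have m: "\<bar>Re (\<kappa> z)\<bar> \<le> M" "\<bar>Im (\<kappa> z)\<bar> \<le> M"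
      using M\<kappa>[OF z] abs_Re_le_cmod abs_Im_le_cmod order_trans by blast+
    \<comment> \<open>Left of \<open>ln \<rho>\<close> the shift by \<open>3 * \<alpha> / 4\<close>
      suffices; elsewhere the choice of \<open>a\<close> leaves room for a displacement of size
      \<open>M\<close>.\<close>
    have "- A \<le> Re z + Re (\<kappa> z)"
    proof (cases "exp (Re z) < \<rho>")
      case True
      then have "3 * \<alpha> / 4 \<le> Re (\<kappa> z)" unfolding \<kappa>_def by (intro \<rho>) simp
      then show ?thesis using z' by (simp add: A_def)
    next
      case False
      then have "ln \<rho> \<le> Re z" using \<open>\<rho> > 0\<close> by (metis exp_le_cancel_iff exp_ln not_less)
      then show ?thesis using m a unfolding A_def by linarith
    qed
    moreover have "b \<le> 0" using \<open>\<alpha> > 0\<close> by (simp add: b_def)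
    ultimately show ?thesis using m z' a unfolding A_def by auto
  qed
  let ?B = "cbox (vec2 (Complex (-A) (-(Y+M)))) (vec2 (Complex A (Y+M)))"
  have SB: "S \<subseteq> ?B" "uminus ` S \<subseteq> ?B"
  proof -
    have "vec2 w \<in> ?B" "- vec2 w \<in> ?B" if "\<bar>Re w\<bar> \<le> A \<and> \<bar>Im w\<bar> \<le> Y + M" for w
      using that by (auto simp: mem_box_cart forall_2)
    then show "S \<subseteq> ?B" "uminus ` S \<subseteq> ?B"
      using f_in unfolding S_def by blast+
  qed
  \<comment> \<open>Opposite image points would multiply, after exponentiation, to
    \<open>h (exp z) * h (exp w) = 1\<close>.\<close>
  have "S \<inter> uminus ` S = {}"
  proof -
    have False if zw: "z \<in> ?Q" "w \<in> ?Q" "vec2 (?f z) = - vec2 (?f w)" for z w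
    proof -
      have U: "z \<in> U" "w \<in> U" using zw QU by auto
      have "?f z + ?f w = 0"
        using zw(3) by (simp add: vec_eq_iff forall_2 complex_eq_iff)
      moreover have "exp (?f z + ?f w) = h (exp z) * h (exp w)"
        by (simp only: exp_add[of "?f z" "?f w"] exp_f U)
      ultimately show False
        using ne1[OF expU[OF U(1)] expU[OF U(2)]] by simp
    qed
    then show ?thesis
      unfolding S_def disjoint_iff image_image by (metis (no_types, lifting) imageE)
  qed
  then have "2 * measure lebesgue S = measure lebesgue (S \<union> uminus ` S)"
    using measure_Un3[OF S(1) T(1)] T(2) by simp
  also have "\<dots> \<le> measure lebesgue ?B"
    using SB S(1) T(1) by (intro measure_mono_fmeasurable) auto
  also have "\<dots> = (2 * A) * (2 * (Y + M))"
    using \<open>A \<ge> M\<close> M0 \<open>Y \<ge> 0\<close> by (subst content_cbox_vec2) auto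
  finally have "2 * ((b - a) * (2 * Y - 4 * M)) \<le> (2 * A) * (2 * (Y + M))"
    using S(2) by linarith
  moreover have "b - a = A + \<alpha> / 2" by (simp add: A_def b_def)
  ultimately have "(A + \<alpha> / 2) * (Y - 2 * M) \<le> A * (Y + M)" by (simp add: algebra_simps)
  then have "\<alpha> * Y \<le> 2 * (3 * A * M + \<alpha> * M)" by (simp add: algebra_simps)
  moreover have "\<alpha> * Y = 2 * (3 * A * M + \<alpha> * M) + \<alpha>"
    using \<open>\<alpha> > 0\<close> by (simp add: Y_def field_simps)
  ultimately show False using \<open>\<alpha> > 0\<close> by simp
qed

section \<open>Omitted values of normalized univalent functions\<close>

lemma Koebe_one_quarter:
  assumes holg: "g holomorphic_on ball 0 1" and inj: "inj_on g (ball 0 1)"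
    and "g 0 = 0" "deriv g 0 = 1"
  shows "ball 0 (1/4) \<subseteq> g ` ball 0 1"
proof
  fix w :: complex assume w: "w \<in> ball 0 (1/4)"
  show "w \<in> g ` ball 0 1"
  proof (rule ccontr)
    assume omit: "w \<notin> g ` ball 0 1"
    then have "w \<noteq> 0" using \<open>g 0 = 0\<close> by (metis centre_in_ball image_eqI zero_less_one)
    have hol1: "(\<lambda>z. 1 - g z / w) holomorphic_on ball 0 1"
      using holg \<open>w \<noteq> 0\<close> by (intro holomorphic_intros) auto
    have nz: "1 - g z / w \<noteq> 0" if "z \<in> ball 0 1" for z
      using omit that \<open>w \<noteq> 0\<close> by (auto simp: field_simps)
    obtain t where holt: "t holomorphic_on ball 0 1"
      and t: "\<And>z. z \<in> ball 0 1 \<Longrightarrow> 1 - g z / w = (t z)\<^sup>2"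
      using contractible_imp_holomorphic_sqrt[OF hol1 convex_imp_contractible[OF convex_ball] nz] by blast
    \<comment> \<open>Since \<open>t 0\<close> is 1 or -1, dividing by it selects the branch with
      value 1 at 0.\<close>
    define s where "s = (\<lambda>z. t z / t 0)"
    have "(t 0)\<^sup>2 = 1" using t[of 0] \<open>g 0 = 0\<close> by simp
    then have s: "(s z)\<^sup>2 = 1 - g z / w" if "z \<in> ball 0 1" for z
      using t[OF that] by (simp add: s_def power_divide)
    have "t 0 \<noteq> 0" using \<open>(t 0)\<^sup>2 = 1\<close> by auto
    then have "s 0 = 1" by (simp add: s_def)
    have hols: "s holomorphic_on ball 0 1"
      unfolding s_def using holt \<open>t 0 \<noteq> 0\<close> by (intro holomorphic_intros) auto
    have sq: "z = z'" if "(s z)\<^sup>2 = (s z')\<^sup>2" "z \<in> ball 0 1" "z' \<in> ball 0 1" for z z'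
      using that s inj \<open>w \<noteq> 0\<close> by (auto simp: inj_on_def)
    \<comment> \<open>The square of \<open>s\<close> is injective, so opposite values can only occur
      at one point, where \<open>s\<close> would vanish and \<open>g\<close> would take the omitted
      value. This yields both \<open>1 + s z \<noteq> 0\<close> and the product condition on
      \<open>h\<close>.\<close>
    have s_ne: "s z + s z' \<noteq> 0" if z: "z \<in> ball 0 1" "z' \<in> ball 0 1" for z z'
    proof
      assume "s z + s z' = 0"
      then have eq: "s z = - s z'" by (simp add: eq_neg_iff_add_eq_0)
      then have "z = z'" using sq z by simp
      with eq have "s z = 0" by simp
      with s[OF z(1)] have "g z = w" using \<open>w \<noteq> 0\<close> by simp
      with omit z show False by blast
    qed
    have s1: "1 + s z \<noteq> 0" if "z \<in> ball 0 1" for z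
      using s_ne[of 0 z] that \<open>s 0 = 1\<close> by simp
    define h where "h = (\<lambda>z. (1 - s z) / (1 + s z))"
    have "cmod (deriv h 0) \<le> 1"
    proof (rule univalent_product_ne_1_deriv_le_1)
      show "h holomorphic_on ball 0 1"
        unfolding h_def using hols s1 by (intro holomorphic_intros) auto
      show "inj_on h (ball 0 1)"
      proof (rule inj_onI)
        fix z z' assume z: "z \<in> ball 0 1" "z' \<in> ball 0 1" "h z = h z'"
        then have "(1 - s z) * (1 + s z') = (1 - s z') * (1 + s z)"
          using s1 by (simp add: h_def frac_eq_eq)
        then have "s z = s z'" by (simp add: algebra_simps)
        then show "z = z'" using sq z by simp
      qed
      show "h 0 = 0" by (simp add: h_def \<open>s 0 = 1\<close>)
      fix z z' :: complex assume z: "z \<in> ball 0 1" "z' \<in> ball 0 1"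
      show "h z * h z' \<noteq> 1"
      proof
        assume "h z * h z' = 1"
        then have "(1 - s z) * (1 - s z') = (1 + s z) * (1 + s z')"
          using s1 z by (simp add: h_def field_simps)
        then have "2 * (s z + s z') = 0" by algebra
        then have "s z + s z' = 0" by (simp only: mult_eq_0_iff) simp
        with s_ne z show False by blast
      qed
    qed
    \<comment> \<open>Differentiating \<open>s^2 = 1 - g / w\<close> at 0 gives
      \<open>deriv s 0 = - 1 / (2 * w)\<close>, and the derivative of
      \<open>(1 - s) / (1 + s)\<close> at 0 is \<open>- deriv s 0 / 2\<close>.\<close>
    moreover have "deriv h 0 = 1 / (4 * w)"
    proof -
      have ds: "(s has_field_derivative deriv s 0) (at 0)"
        using hols by (intro holomorphic_derivI[of _ "ball 0 1"]) auto
      have dg: "(g has_field_derivative 1) (at 0)"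
        using holg \<open>deriv g 0 = 1\<close> holomorphic_derivI[of g "ball 0 1" 0] by simp
      have "((\<lambda>z. 1 - g z / w) has_field_derivative - 1 / w) (at 0)"
        using \<open>w \<noteq> 0\<close> by (auto intro!: derivative_eq_intros dg)
      then have "((\<lambda>z. (s z)\<^sup>2) has_field_derivative - 1 / w) (at 0)"
        by (rule has_field_derivative_transform_within_open[of _ _ _ "ball 0 1"]) (auto simp: s)
      moreover have "((\<lambda>z. (s z)\<^sup>2) has_field_derivative 2 * deriv s 0) (at 0)"
        by (auto intro!: derivative_eq_intros ds simp: \<open>s 0 = 1\<close>)
      ultimately have "2 * deriv s 0 = - 1 / w" by (rule DERIV_unique[symmetric])
      then have "deriv s 0 = - 1 / (2 * w)" using \<open>w \<noteq> 0\<close> by (simp add: field_simps)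
      moreover have "(h has_field_derivative - deriv s 0 / 2) (at 0)"
        unfolding h_def by (auto intro!: derivative_eq_intros ds simp: \<open>s 0 = 1\<close>)
      ultimately show ?thesis by (simp add: DERIV_imp_deriv)
    qed
    ultimately have "1 \<le> 4 * cmod w"
      using \<open>w \<noteq> 0\<close> by (simp add: norm_divide norm_mult field_simps)
    with w show False by simp
  qed
qed

section \<open>Norming functionals\<close>

definition sublinear :: "('a::real_vector \<Rightarrow> real) \<Rightarrow> bool" where
  "sublinear p \<longleftrightarrow> (\<forall>x y. p (x + y) \<le> p x + p y) \<and> (\<forall>x. \<forall>t\<ge>0. p (t *\<^sub>R x) = t * p x)"

lemma sublinear_add: "sublinear p \<Longrightarrow> p (x + y) \<le> p x + p y"
  and sublinear_scale: "sublinear p \<Longrightarrow> t \<ge> 0 \<Longrightarrow> p (t *\<^sub>R x) = t * p x"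
  by (auto simp: sublinear_def)

lemma sublinear_neg: "sublinear p \<Longrightarrow> - p (- x) \<le> p x"
  using sublinear_add[of p x "-x"] sublinear_scale[of p 0 x] by simp

text \<open>A one-direction improvement of \<open>p\<close>: the choice \<open>t = 0\<close> gives
  \<open>q \<le> p\<close>, and \<open>t = 1\<close> at \<open>- u\<close> gives
  \<open>q (- u) \<le> - p u\<close>, which is what additivity along \<open>u\<close>
  demands.\<close>

lemma sublinear_INF_translate:
  fixes u :: "'a::real_vector"
  assumes p: "sublinear p"
    and q_def: "q = (\<lambda>x. INF t\<in>{0..}. p (x + t *\<^sub>R u) - t * p u)"
  shows "sublinear q" "\<And>x t. t \<ge> 0 \<Longrightarrow> q x \<le> p (x + t *\<^sub>R u) - t * p u"
proof -
  let ?g = "\<lambda>x t. p (x + t *\<^sub>R u) - t * p u"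
  \<comment> \<open>Without a lower bound the infimum of reals would carry no information.\<close>
  have lb: "- p (- x) \<le> ?g x t" if "t \<ge> 0" for x t
  proof -
    have "t * p u = p ((x + t *\<^sub>R u) + (- x))"
      using that by (simp add: sublinear_scale[OF p])
    also have "\<dots> \<le> p (x + t *\<^sub>R u) + p (- x)" by (rule sublinear_add[OF p])
    finally show ?thesis by simp
  qed
  have bdd: "bdd_below (?g x ` {0..})" for x
    using lb by (intro bdd_belowI2) auto
  show le: "q x \<le> ?g x t" if "t \<ge> 0" for x t
    unfolding q_def using bdd that by (intro cINF_lower) auto
  have geI: "c \<le> q x" if "\<And>t. t \<ge> 0 \<Longrightarrow> c \<le> ?g x t" for c x
    unfolding q_def using that by (intro cINF_greatest) auto
  show "sublinear q"
    unfolding sublinear_def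
  proof (intro conjI allI impI)
    fix x y
    \<comment> \<open>The parameters for \<open>x\<close> and \<open>y\<close> vary independently;
      their sum serves as parameter for \<open>x + y\<close>.\<close>
    have "q (x + y) - ?g x s \<le> q y" if "s \<ge> 0" for s
    proof (rule geI)
      fix t :: real assume "t \<ge> 0"
      have "q (x + y) \<le> ?g (x + y) (s + t)" using \<open>s \<ge> 0\<close> \<open>t \<ge> 0\<close> by (intro le) simp
      also have "x + y + (s + t) *\<^sub>R u = (x + s *\<^sub>R u) + (y + t *\<^sub>R u)" by (simp add: scaleR_left_distrib)
      also have "p \<dots> \<le> p (x + s *\<^sub>R u) + p (y + t *\<^sub>R u)" by (rule sublinear_add[OF p])
      finally show "q (x + y) - ?g x s \<le> ?g y t" by (simp add: algebra_simps)
    qed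
    then have "q (x + y) - q y \<le> q x" by (intro geI) (simp add: algebra_simps)
    then show "q (x + y) \<le> q x + q y" by simp
  next
    \<comment> \<open>Rescaling the parameter from \<open>s\<close> to \<open>t * s\<close> gives
      one inequality; the converse follows by applying it to \<open>inverse t\<close>.\<close>
    have *: "q (t *\<^sub>R x) \<le> t * q x" if "t > 0" for t x
    proof -
      have "q (t *\<^sub>R x) / t \<le> q x"
      proof (rule geI)
        fix s :: real assume "s \<ge> 0"
        have "q (t *\<^sub>R x) \<le> ?g (t *\<^sub>R x) (t * s)" using \<open>t > 0\<close> \<open>s \<ge> 0\<close> by (intro le) simp
        also have "t *\<^sub>R x + (t * s) *\<^sub>R u = t *\<^sub>R (x + s *\<^sub>R u)" by (simp add: scaleR_right_distrib)
        also have "p \<dots> = t * p (x + s *\<^sub>R u)" using \<open>t > 0\<close> by (simp add: sublinear_scale[OF p])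
        finally show "q (t *\<^sub>R x) / t \<le> ?g x s" using \<open>t > 0\<close> by (simp add: field_simps)
      qed
      then show ?thesis using \<open>t > 0\<close> by (simp add: field_simps)
    qed
    have q0: "q 0 = 0"
    proof (rule antisym)
      show "q 0 \<le> 0" using le[of 0 0] sublinear_scale[OF p, of 0 0] by simp
      show "0 \<le> q 0" by (rule geI) (simp add: sublinear_scale[OF p])
    qed
    fix x :: 'a and t :: real assume "t \<ge> 0"
    show "q (t *\<^sub>R x) = t * q x"
    proof (cases "t = 0")
      case False
      with \<open>t \<ge> 0\<close> have "t > 0" by simp
      have "q (inverse t *\<^sub>R (t *\<^sub>R x)) \<le> inverse t * q (t *\<^sub>R x)"
        using \<open>t > 0\<close> by (intro *) simp
      then have "t * q x \<le> q (t *\<^sub>R x)"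
        using \<open>t > 0\<close> by (simp add: field_simps)
      with *[OF \<open>t > 0\<close>] show ?thesis by (intro antisym)
    qed (simp add: q0)
  qed
qed

text \<open>Zorn's lemma for the reversed pointwise order. A nonempty chain is bounded by its
  pointwise infimum, which is finite because every member satisfies
  \<open>- p (- x) \<le> - q (- x) \<le> q x\<close>.\<close>

lemma minimal_sublinear_exists:
  assumes p: "sublinear p"
  obtains m where "sublinear m" "m \<le> p" "\<And>q. sublinear q \<Longrightarrow> q \<le> m \<Longrightarrow> q = m"
proof -
  let ?A = "{q. sublinear q \<and> q \<le> p}"
  have "\<exists>m\<in>?A. \<forall>q\<in>?A. m \<ge> q \<longrightarrow> q = m"
  proof (rule predicate_Zorn)
    show "partial_order_on ?A (relation_of (\<lambda>x y. y \<le> x) ?A)"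
      by (auto simp: partial_order_on_def preorder_on_def refl_on_def trans_def antisym_def relation_of_def
          intro: order_trans)
    fix C assume C: "C \<in> Chains (relation_of (\<lambda>x y. y \<le> x) ?A)"
    show "\<exists>u\<in>?A. \<forall>q\<in>C. u \<le> q"
    proof (cases "C = {}")
      case True
      then show ?thesis using p by blast
    next
      case False
      have CA: "sublinear q" "q \<le> p" if "q \<in> C" for q
        using C that unfolding Chains_def relation_of_def by blast+
      have tot: "q \<le> q' \<or> q' \<le> q" if "q \<in> C" "q' \<in> C" for q q'
        using C that unfolding Chains_def relation_of_def by blast
      define m where "m = (\<lambda>x. INF q\<in>C. q x)"
      have bdd: "bdd_below ((\<lambda>q. q x) ` C)" for x
      proof (rule bdd_belowI2)
        fix q assume "q \<in> C"
        then show "- p (- x) \<le> q x"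
          using sublinear_neg[OF CA(1), of q x] CA(2)[THEN le_funD, of q "-x"] by simp
      qed
      have le: "m x \<le> q x" if "q \<in> C" for q x
        unfolding m_def using bdd that by (intro cINF_lower)
      have geI: "c \<le> m x" if "\<And>q. q \<in> C \<Longrightarrow> c \<le> q x" for c x
        unfolding m_def using that False by (intro cINF_greatest)
      have "sublinear m"
        unfolding sublinear_def
      proof (intro conjI allI impI)
        fix x y
        have "m (x + y) - q x \<le> m y" if "q \<in> C" for q
        proof (rule geI)
          fix q' assume "q' \<in> C"
          \<comment> \<open>Subadditivity of the infimum needs the chain property: the smaller of
            two members serves both summands at once.\<close>
          obtain r where r: "r \<in> C" "r \<le> q" "r \<le> q'"
            using tot[OF \<open>q \<in> C\<close> \<open>q' \<in> C\<close>] \<open>q \<in> C\<close> \<open>q' \<in> C\<close> by blast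
          have "m (x + y) \<le> r (x + y)" using le r by blast
          also have "\<dots> \<le> r x + r y" using CA r sublinear_add by blast
          also have "\<dots> \<le> q x + q' y" using r by (intro add_mono) (auto simp: le_fun_def)
          finally show "m (x + y) - q x \<le> q' y" by simp
        qed
        then have "m (x + y) - m y \<le> m x" by (intro geI) (simp add: algebra_simps)
        then show "m (x + y) \<le> m x + m y" by simp
      next
        fix x :: 'a and t :: real assume t: "t \<ge> 0"
        show "m (t *\<^sub>R x) = t * m x"
        proof (cases "t = 0")
          case True
          have "(\<lambda>q. q 0) ` C = {0}"
            using False CA(1) sublinear_scale[where t=0 and x=0] by force
          then show ?thesis using True by (simp add: m_def)
        next
          case False
          then have "t > 0" using t by simp
          show ?thesis
          proof (rule antisym)
            have "m (t *\<^sub>R x) / t \<le> m x"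
            proof (rule geI)
              fix q assume q: "q \<in> C"
              have "m (t *\<^sub>R x) \<le> t * q x" using le[OF q, of "t *\<^sub>R x"] sublinear_scale[OF CA(1)[OF q] t] by simp
              then show "m (t *\<^sub>R x) / t \<le> q x" using \<open>t > 0\<close> by (simp add: field_simps)
            qed
            then show "m (t *\<^sub>R x) \<le> t * m x" using \<open>t > 0\<close> by (simp add: field_simps)
            show "t * m x \<le> m (t *\<^sub>R x)"
            proof (rule geI)
              fix q assume q: "q \<in> C"
              show "t * m x \<le> q (t *\<^sub>R x)"
                using le[OF q, of x] t by (simp add: sublinear_scale[OF CA(1)[OF q] t] mult_left_mono)
            qed
          qed
        qed
      qed
      moreover have "m \<le> p"
        using False le CA(2) by (metis all_not_in_conv le_fun_def order_trans)
      moreover have "\<forall>q\<in>C. m \<le> q" using le by (simp add: le_fun_def)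
      ultimately show ?thesis by blast
    qed
  qed
  then obtain m where m: "sublinear m" "m \<le> p" and min: "\<And>q. q \<in> ?A \<Longrightarrow> q \<le> m \<Longrightarrow> q = m"
    by blast
  show thesis
  proof (rule that[OF m])
    fix q assume "sublinear q" "q \<le> m"
    then show "q = m" using min m(2) order_trans by blast
  qed
qed

text \<open>Sublinear functionals that are minimal in the pointwise order are exactly the linear ones; this and Zorn's
  lemma replace the extension argument in the usual proof of the Hahn--Banach theorem.\<close>

lemma minimal_sublinear_linear:
  assumes m: "sublinear m" and min: "\<And>q. sublinear q \<Longrightarrow> q \<le> m \<Longrightarrow> q = m"
  shows "linear m"
proof -
  have add: "m (x + u) = m x + m u" for x u
  proof -
    \<comment> \<open>By minimality this improvement along \<open>u\<close> is \<open>m\<close>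
      itself, so its bound at \<open>t = 1\<close> is the missing superadditivity.\<close>
    define q where "q = (\<lambda>x. INF t\<in>{0..}. m (x + t *\<^sub>R u) - t * m u)"
    note q = sublinear_INF_translate[OF m q_def]
    have "q \<le> m" using q(2)[of 0] by (simp add: le_fun_def)
    then have "q = m" using q(1) min by blast
    then have "m x \<le> m (x + u) - m u" using q(2)[of 1 x] by simp
    with sublinear_add[OF m, of x u] show ?thesis by simp
  qed
  show ?thesis
  proof (rule linearI)
    show "m (x + y) = m x + m y" for x y by (rule add)
    have neg: "m (- x) = - m x" for x
      using add[of x "-x"] sublinear_scale[OF m, of 0 x] by simp
    show "m (t *\<^sub>R x) = t *\<^sub>R m x" for t x
    proof (cases "t \<ge> 0")
      case False
      then have "m ((- t) *\<^sub>R x) = (- t) * m x" by (intro sublinear_scale[OF m]) simp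
      then show ?thesis using neg[of "t *\<^sub>R x"] by simp
    qed (simp add: sublinear_scale[OF m])
  qed
qed

text \<open>Before minimizing, the norm is improved along \<open>u\<close>. Any linear
  \<open>l\<close> below the result has \<open>l (- u) \<le> - norm u\<close>, hence
  \<open>l u \<ge> norm u\<close>.\<close>

lemma real_norming_functional:
  fixes u :: "'a::real_normed_vector"
  obtains l where "linear l" "l u = norm u" "\<And>x. l x \<le> norm x"
proof -
  have N: "sublinear (norm :: 'a \<Rightarrow> real)"
    by (simp add: sublinear_def norm_triangle_ineq)
  define p where "p = (\<lambda>x. INF t\<in>{0..}. norm (x + t *\<^sub>R u) - t * norm u)"
  note p = sublinear_INF_translate[OF N p_def]
  obtain l where l: "sublinear l" "l \<le> p" "\<And>q. sublinear q \<Longrightarrow> q \<le> l \<Longrightarrow> q = l"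
    using minimal_sublinear_exists[OF p(1)] by blast
  have lin: "linear l" using l minimal_sublinear_linear by blast
  have le: "l x \<le> norm x" for x
    using p(2)[of 0 x] l(2)[THEN le_funD, of x] by simp
  have "l (- u) \<le> - norm u"
    using p(2)[of 1 "-u"] l(2)[THEN le_funD, of "-u"] by simp
  then have "l u = norm u"
    using le[of u] linear_neg[OF lin, of u] by simp
  with lin le that show thesis by blast
qed

section \<open>From real to complex norming functionals\<close>

lemma scaleC_zero_left [simp]: "0 *\<^sub>C x = 0"
  using scaleC_of_real[of 0 x] by simp

lemma scaleC_minus_left: "(- a) *\<^sub>C x = - (a *\<^sub>C x)"
  using scaleC_add_left[of a "- a" x] by (simp add: eq_neg_iff_add_eq_0 add.commute)

lemma complex_norming_functional:
  fixes u :: "'a::complex_normed_vector"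
  assumes "norm u = 1"
  obtains l :: "'a \<Rightarrow> complex" where "bounded_linear l" "\<And>a x. l (a *\<^sub>C x) = a * l x"
    "l u = 1" "\<And>x. cmod (l x) \<le> norm x"
proof -
  obtain g where g: "linear g" "g u = norm u" "\<And>x. g x \<le> norm x"
    using real_norming_functional[of u] by blast
  \<comment> \<open>The only complex-linear functional with real part \<open>g\<close>: its
    imaginary part at \<open>x\<close> must be minus its real part at
    \<open>\<i> *\<^sub>C x\<close>.\<close>
  define l where "l x = Complex (g x) (- g (\<i> *\<^sub>C x))" for x
  have lin: "linear l"
  proof (rule linearI)
    show "l (x + y) = l x + l y" for x y
      by (simp add: l_def scaleC_add_right linear_add[OF g(1)] complex_eq_iff)
    have "\<i> *\<^sub>C (t *\<^sub>R x) = t *\<^sub>R (\<i> *\<^sub>C x)" for t and x :: 'a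
      by (metis scaleC_of_real scaleC_scaleC mult.commute)
    then show "l (t *\<^sub>R x) = t *\<^sub>R l x" for t x
      by (simp add: l_def linear_scale[OF g(1)] complex_eq_iff)
  qed
  have li: "l (\<i> *\<^sub>C x) = \<i> * l x" for x
    by (simp add: l_def scaleC_scaleC scaleC_minus_left scaleC_one linear_neg[OF g(1)] complex_eq_iff)
  have hom: "l (a *\<^sub>C x) = a * l x" for a x
  proof -
    have "a *\<^sub>C x = (complex_of_real (Re a) + complex_of_real (Im a) * \<i>) *\<^sub>C x"
      using arg_cong[OF complex_eq[of a], of "\<lambda>c. c *\<^sub>C x"] by (simp only: mult.commute)
    also have "\<dots> = Re a *\<^sub>R x + Im a *\<^sub>R (\<i> *\<^sub>C x)"
      by (simp add: scaleC_add_left scaleC_of_real flip: scaleC_scaleC)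
    finally have "l (a *\<^sub>C x) = Re a *\<^sub>R l x + Im a *\<^sub>R (\<i> * l x)"
      by (simp only: linear_add[OF lin] linear_scale[OF lin] li)
    also have "\<dots> = (complex_of_real (Re a) + \<i> * complex_of_real (Im a)) * l x"
      by (simp add: scaleR_conv_of_real algebra_simps)
    finally show ?thesis by (simp only: complex_eq[symmetric])
  qed
  have bound: "cmod (l x) \<le> norm x" for x
  proof (cases "l x = 0")
    case False
    \<comment> \<open>A rotation making \<open>l (c *\<^sub>C x)\<close> real and equal to
      \<open>cmod (l x)\<close>, so that the bound on the real part \<open>g\<close>
      applies.\<close>
    define c where "c = cnj (sgn (l x))"
    have "cmod c = 1" using False by (simp add: c_def norm_sgn)
    have "l (c *\<^sub>C x) = (l x * cnj (l x)) / complex_of_real (cmod (l x))"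
      by (simp add: hom c_def sgn_eq)
    also have "\<dots> = complex_of_real (cmod (l x))"
      unfolding complex_norm_square[symmetric] using False by (simp add: power2_eq_square)
    finally have "l (c *\<^sub>C x) = complex_of_real (cmod (l x))" .
    then have "cmod (l x) = g (c *\<^sub>C x)" by (simp add: l_def complex_eq_iff)
    also have "\<dots> \<le> norm x" using g(3)[of "c *\<^sub>C x"] \<open>cmod c = 1\<close> by (simp add: norm_scaleC)
    finally show ?thesis .
  qed simp
  have "bounded_linear l"
    using lin bound by (intro linear_conv_bounded_linear[THEN iffD1] bounded_linear_intro[where K=1])
      (auto simp: linear_add linear_scale)
  \<comment> \<open>The real part is already 1, and the bound by the norm leaves no room for an
    imaginary part.\<close>
  moreover have "l u = 1"
  proof -
    have "Re (l u) = 1" using g(2) assms by (simp add: l_def)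
    moreover have "(Re (l u))\<^sup>2 + (Im (l u))\<^sup>2 \<le> 1"
      using bound[of u] assms by (simp add: cmod_def)
    ultimately show ?thesis by (simp add: complex_eq_iff)
  qed
  ultimately show thesis using hom bound that by blast
qed

section \<open>The one-quarter theorem in Banach spaces\<close>

lemma bounded_bilinear_scaleC: "bounded_bilinear (scaleC :: complex \<Rightarrow> 'a \<Rightarrow> 'a::complex_normed_vector)"
proof
  show "(r *\<^sub>R a) *\<^sub>C b = r *\<^sub>R (a *\<^sub>C b)" for r a and b :: 'a
    by (metis scaleC_of_real scaleC_scaleC scaleR_conv_of_real)
  show "a *\<^sub>C (r *\<^sub>R b) = r *\<^sub>R (a *\<^sub>C b)" for r a and b :: 'a
    by (metis mult.commute scaleC_of_real scaleC_scaleC)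
  show "\<exists>K. \<forall>a (b :: 'a). norm (a *\<^sub>C b) \<le> norm a * norm b * K"
    by (intro exI[of _ 1]) (simp add: norm_scaleC)
qed (simp_all add: scaleC_add_left scaleC_add_right)

lemma scaleC_zero_right [simp]: "a *\<^sub>C (0::'a::complex_normed_vector) = 0"
  using norm_scaleC[of a "0::'a"] by simp

section \<open>Calculus of holomorphic maps between complex normed spaces\<close>

lemma holomorphic_map_on_cong:
  assumes f: "holomorphic_map_on f S" and eq: "\<And>x. x \<in> S \<Longrightarrow> f x = g x"
  shows "holomorphic_map_on g S"
  using f has_derivative_transform_within_open[of f _ _ UNIV S g] eq
  unfolding holomorphic_map_on_def by metis

lemma holomorphic_map_on_imp_continuous_on: "holomorphic_map_on f S \<Longrightarrow> continuous_on S f"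
  unfolding holomorphic_map_on_def
  by (metis continuous_at_imp_continuous_on has_derivative_continuous)

lemma holomorphic_map_on_compose:
  assumes g: "holomorphic_map_on g T" and f: "holomorphic_map_on f S" and "f ` S \<subseteq> T"
  shows "holomorphic_map_on (\<lambda>x. g (f x)) S"
  unfolding holomorphic_map_on_def
proof (intro conjI ballI)
  show "open S" using f by (simp add: holomorphic_map_on_def)
  fix x assume "x \<in> S"
  obtain D where D: "(f has_derivative D) (at x)" "\<And>a y. D (a *\<^sub>C y) = a *\<^sub>C D y"
    using f \<open>x \<in> S\<close> unfolding holomorphic_map_on_def by blast
  have "f x \<in> T" using assms(3) \<open>x \<in> S\<close> by blast
  then obtain E where E: "(g has_derivative E) (at (f x))" "\<And>a y. E (a *\<^sub>C y) = a *\<^sub>C E y"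
    using g unfolding holomorphic_map_on_def by blast
  have "((\<lambda>x. g (f x)) has_derivative (\<lambda>y. E (D y))) (at x)"
    using diff_chain_at[OF D(1) E(1)] by (simp add: o_def)
  moreover have "E (D (a *\<^sub>C y)) = a *\<^sub>C E (D y)" for a y by (simp add: D(2) E(2))
  ultimately show "\<exists>D. ((\<lambda>x. g (f x)) has_derivative D) (at x) \<and> (\<forall>a y. D (a *\<^sub>C y) = a *\<^sub>C D y)"
    by (intro exI[of _ "\<lambda>y. E (D y)"]) simp
qed

lemma bounded_linear_imp_holomorphic_map_on:
  assumes "bounded_linear f" "\<And>a x. f (a *\<^sub>C x) = a *\<^sub>C f x" "open S"
  shows "holomorphic_map_on f S"
  unfolding holomorphic_map_on_def
  using assms bounded_linear_imp_has_derivative[OF assms(1)] by blast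

lemma holomorphic_map_on_scaleC:
  assumes f: "holomorphic_map_on f S"
  shows "holomorphic_map_on (\<lambda>x. f x *\<^sub>C x) S"
  unfolding holomorphic_map_on_def
proof (intro conjI ballI)
  show "open S" using f by (simp add: holomorphic_map_on_def)
  fix x assume "x \<in> S"
  then obtain D where D: "(f has_derivative D) (at x)" "\<And>a y. D (a *\<^sub>C y) = a *\<^sub>C D y"
    using f unfolding holomorphic_map_on_def by blast
  have "((\<lambda>x. f x *\<^sub>C x) has_derivative (\<lambda>h. f x *\<^sub>C h + D h *\<^sub>C x)) (at x)"
    by (rule bounded_bilinear.FDERIV[OF bounded_bilinear_scaleC D(1) has_derivative_ident])
  moreover have "f x *\<^sub>C (a *\<^sub>C y) + D (a *\<^sub>C y) *\<^sub>C x = a *\<^sub>C (f x *\<^sub>C y + D y *\<^sub>C x)" for a y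
    by (simp add: D(2) scaleC_complex_def scaleC_add_right scaleC_scaleC mult.commute)
  ultimately show "\<exists>D. ((\<lambda>x. f x *\<^sub>C x) has_derivative D) (at x) \<and> (\<forall>a y. D (a *\<^sub>C y) = a *\<^sub>C D y)"
    by (intro exI[of _ "\<lambda>h. f x *\<^sub>C h + D h *\<^sub>C x"]) blast
qed

section \<open>Covering by restriction to complex lines\<close>

text \<open>Since \<open>F x\<close> is a multiple of \<open>x\<close>, the complex line through a
  nonzero \<open>x\<close> is preserved, and \<open>x\<close> is covered once the number
  \<open>norm x\<close> is covered by the slice function of that line.\<close>

lemma quarter_ball_subset_image:
  fixes f :: "'a::complex_normed_vector \<Rightarrow> complex"
  assumes inj: "inj_on F (ball 0 1)" and f: "holomorphic_map_on f (ball 0 1)" "f 0 = 1"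
    and F: "\<And>x. x \<in> ball 0 1 \<Longrightarrow> F x = f x *\<^sub>C x" and x: "norm x < 1/4"
  shows "x \<in> F ` ball 0 1"
proof (cases "x = 0")
  case True
  then show ?thesis by (intro image_eqI[of _ _ 0]) (simp_all add: F)
next
  case False
  define u where "u = complex_of_real (inverse (norm x)) *\<^sub>C x"
  have "norm u = 1" using False by (simp add: u_def norm_scaleC norm_inverse)
  have xu: "x = complex_of_real (norm x) *\<^sub>C u"
    using False by (simp add: u_def scaleC_scaleC scaleC_one)
  have in_ball: "z *\<^sub>C u \<in> ball 0 1" if "z \<in> ball 0 1" for z
    using that \<open>norm u = 1\<close> by (simp add: norm_scaleC)
  have "holomorphic_map_on (\<lambda>z. z *\<^sub>C u) (ball 0 1)"
    by (rule bounded_linear_imp_holomorphic_map_on)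
       (auto simp: scaleC_scaleC scaleC_complex_def intro: bounded_bilinear.bounded_linear_left[OF bounded_bilinear_scaleC])
  then have "holomorphic_map_on (\<lambda>z. f (z *\<^sub>C u)) (ball 0 1)"
    using in_ball by (intro holomorphic_map_on_compose[OF f(1)]) auto
  then have hol: "(\<lambda>z. f (z *\<^sub>C u)) holomorphic_on ball 0 1"
    by (simp add: holomorphic_map_on_complex_iff)
  \<comment> \<open>The coordinate of \<open>F (z *\<^sub>C u)\<close> with respect to
    \<open>u\<close>; its derivative at 0 is \<open>f 0 = 1\<close>.\<close>
  define g where "g = (\<lambda>z. f (z *\<^sub>C u) * z)"
  have gF: "g z *\<^sub>C u = F (z *\<^sub>C u)" if "z \<in> ball 0 1" for z
    by (simp add: F[OF in_ball[OF that]] g_def scaleC_scaleC)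
  have "ball 0 (1/4) \<subseteq> g ` ball 0 1"
  proof (rule Koebe_one_quarter)
    show "g holomorphic_on ball 0 1" unfolding g_def by (intro holomorphic_intros hol)
    show "inj_on g (ball 0 1)"
    proof (rule inj_onI)
      fix z w assume zw: "z \<in> ball 0 1" "w \<in> ball 0 1" "g z = g w"
      then have "F (z *\<^sub>C u) = F (w *\<^sub>C u)" by (metis gF)
      then have "z *\<^sub>C u = w *\<^sub>C u" using inj in_ball zw by (meson inj_onD)
      then have "(z - w) *\<^sub>C u = 0"
        using scaleC_add_left[of "z - w" w u] by simp
      then show "z = w" using \<open>norm u = 1\<close> norm_scaleC[of "z - w" u] by simp
    qed
    show "g 0 = 0" by (simp add: g_def)
    have "((\<lambda>z. f (z *\<^sub>C u)) has_field_derivative deriv (\<lambda>z. f (z *\<^sub>C u)) 0) (at 0)"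
      using hol by (intro holomorphic_derivI[of _ "ball 0 1"]) auto
    from DERIV_mult[OF this DERIV_ident] show "deriv g 0 = 1"
      by (simp add: g_def DERIV_imp_deriv f(2))
  qed
  moreover have "complex_of_real (norm x) \<in> ball 0 (1/4)" using x by simp
  ultimately obtain z where "z \<in> ball 0 1" "g z = complex_of_real (norm x)"
    by (metis imageE subsetD)
  then have "F (z *\<^sub>C u) = x" using gF xu by metis
  then show ?thesis using in_ball \<open>z \<in> ball 0 1\<close> by blast
qed

section \<open>The extremal function and its lift\<close>

text \<open>Two identities: \<open>z * (1 - w)^2 - w * (1 - z)^2 = (z - w) * (1 - z * w)\<close>
  gives injectivity, and \<open>4 * z + (1 - z)^2 = (z + 1)^2\<close> shows that -1/4 would be
  attained only at -1.\<close>

lemma Koebe_function: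
  defines "k \<equiv> \<lambda>z::complex. z / (1 - z)\<^sup>2"
  shows "k holomorphic_on ball 0 1" "inj_on k (ball 0 1)" "- (1/4) \<notin> k ` ball 0 1"
proof -
  have ne: "1 - z \<noteq> 0" if "z \<in> ball 0 1" for z :: complex using that by auto
  show "k holomorphic_on ball 0 1"
    unfolding k_def using ne by (intro holomorphic_intros) auto
  show "inj_on k (ball 0 1)"
  proof (rule inj_onI)
    fix z w assume zw: "z \<in> ball 0 1" "w \<in> ball 0 1" "k z = k w"
    then have "z * (1 - w)\<^sup>2 = w * (1 - z)\<^sup>2"
      using ne by (simp add: k_def frac_eq_eq)
    then have "(z - w) * (1 - z * w) = 0" by algebra
    moreover have "cmod (z * w) < 1 * 1"
      unfolding norm_mult using zw by (intro mult_strict_mono') auto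
    then have "z * w \<noteq> 1" by auto
    ultimately show "z = w" by simp
  qed
  show "- (1/4) \<notin> k ` ball 0 1"
  proof
    assume "- (1/4) \<in> k ` ball 0 1"
    then obtain z :: complex where z: "z \<in> ball 0 1" "z / (1 - z)\<^sup>2 = - (1/4)" by (auto simp: k_def)
    then have "z * 4 = - (1 - z)\<^sup>2" using ne[OF z(1)] by (simp add: field_simps)
    then have "(z + 1)\<^sup>2 = 0" by algebra
    then have "z = - 1" by (simp add: add_eq_0_iff2)
    with z(1) show False by simp
  qed
qed

text \<open>The functional intertwines \<open>F\<close> with the Koebe function \<open>k\<close>:
  \<open>l (F x) = k (l x)\<close>. Hence \<open>l x\<close> is recovered from \<open>l y\<close>
  for \<open>y = F x\<close>, and then \<open>x\<close> is \<open>y\<close> divided by the scalar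
  \<open>f x\<close>.\<close>

lemma Koebe_map_biholomorphic:
  fixes l :: "'a::complex_normed_vector \<Rightarrow> complex"
  assumes l: "bounded_linear l" "\<And>a x. l (a *\<^sub>C x) = a * l x" "\<And>x. cmod (l x) \<le> norm x"
  defines "f \<equiv> \<lambda>x. 1 / (1 - l x)\<^sup>2"
  defines "F \<equiv> \<lambda>x. f x *\<^sub>C x"
  shows "biholomorphic_on F (ball 0 1)" "holomorphic_map_on f (ball 0 1)"
    "\<And>y. y \<in> F ` ball 0 1 \<Longrightarrow> l y \<noteq> - (1/4)"
proof -
  let ?B = "ball 0 1 :: 'a set" and ?D = "ball 0 1 :: complex set"
  define k where "k = (\<lambda>z::complex. z / (1 - z)\<^sup>2)"
  note k = Koebe_function[folded k_def]
  have lB: "l x \<in> ?D" if "x \<in> ?B" for x using l(3)[of x] that by simp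
  have holl: "holomorphic_map_on l S" if "open S" for S
    using l(1,2) that by (intro bounded_linear_imp_holomorphic_map_on) (auto simp: scaleC_complex_def)
  have ne: "1 - z \<noteq> 0" if "z \<in> ?D" for z using that by auto
  have "(\<lambda>z. 1 / (1 - z)\<^sup>2) holomorphic_on ?D"
    using ne by (intro holomorphic_intros) auto
  then have "holomorphic_map_on (\<lambda>z. 1 / (1 - z)\<^sup>2) ?D"
    by (simp add: holomorphic_map_on_complex_iff)
  then show holf: "holomorphic_map_on f ?B"
    unfolding f_def by (rule holomorphic_map_on_compose[OF _ holl[OF open_ball]]) (use lB in blast)
  have lF: "l (F x) = k (l x)" for x
    by (simp add: F_def f_def k_def l(2))
  have "l (F x) \<noteq> - (1/4)" if "x \<in> ?B" for x
    using k(3) lB[OF that] unfolding lF by (metis imageI)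
  then show "l y \<noteq> - (1/4)" if "y \<in> F ` ?B" for y
    using that by blast
  have opk: "open (k ` ?D)"
    by (rule open_mapping_thm3[OF k(1) open_ball k(2)])
  obtain \<kappa> where hol\<kappa>: "\<kappa> holomorphic_on k ` ?D" and \<kappa>: "\<And>z. z \<in> ?D \<Longrightarrow> \<kappa> (k z) = z"
    by (rule holomorphic_has_inverse[OF k(1) open_ball k(2)]) (rule that)
  \<comment> \<open>An open set on which the formula for the inverse makes sense; its points need
    not lie in the image of the ball.\<close>
  define W where "W = l -` (k ` ?D)"
  have "open W"
    unfolding W_def using opk linear_continuous_on[OF l(1), of UNIV] by (rule open_vimage)
  \<comment> \<open>The inverse of \<open>F\<close>: \<open>\<kappa> (l y)\<close> plays the role of
    \<open>l x\<close>, so the scalar undoes \<open>1 / (1 - l x)^2\<close>.\<close>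
  define G where "G = (\<lambda>y. (1 - \<kappa> (l y))\<^sup>2 *\<^sub>C y)"
  have "(\<lambda>z. (1 - \<kappa> z)\<^sup>2) holomorphic_on k ` ?D"
    by (intro holomorphic_intros hol\<kappa>)
  then have "holomorphic_map_on (\<lambda>z. (1 - \<kappa> z)\<^sup>2) (k ` ?D)"
    by (simp add: holomorphic_map_on_complex_iff[OF opk])
  then have "holomorphic_map_on (\<lambda>y. (1 - \<kappa> (l y))\<^sup>2) W"
    by (rule holomorphic_map_on_compose[OF _ holl[OF \<open>open W\<close>]]) (auto simp: W_def)
  then have holG: "holomorphic_map_on G W"
    unfolding G_def by (rule holomorphic_map_on_scaleC)
  have GF: "G (F x) = x" if "x \<in> ?B" for x
    using ne[OF lB[OF that]] by (simp add: G_def lF \<kappa>[OF lB[OF that]]) (simp add: F_def f_def scaleC_scaleC scaleC_one)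
  have inj: "inj_on F ?B" using GF by (metis inj_on_inverseI)
  have FG: "F (G y) = y" if "y \<in> W" for y
  proof -
    obtain z where z: "z \<in> ?D" "l y = k z" using \<open>y \<in> W\<close> unfolding W_def by blast
    have "l (G y) = z"
      using ne[OF z(1)] by (simp add: G_def l(2) z(2) \<kappa>[OF z(1)]) (simp add: k_def)
    then show ?thesis
      using ne[OF z(1)] by (simp add: F_def f_def) (simp add: G_def z(2) \<kappa>[OF z(1)] scaleC_scaleC scaleC_one)
  qed
  \<comment> \<open>This description makes the image open, as a preimage of the ball under the
    continuous \<open>G\<close> within the open \<open>W\<close>.\<close>
  have image: "F ` ?B = W \<inter> G -` ?B"
  proof (intro equalityI subsetI)
    fix y assume "y \<in> F ` ?B"
    then obtain x where x: "x \<in> ?B" "y = F x" by blast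
    then show "y \<in> W \<inter> G -` ?B" using GF[OF x(1)] lF lB by (simp add: W_def)
  next
    fix y assume "y \<in> W \<inter> G -` ?B"
    then show "y \<in> F ` ?B" using FG by (metis IntE image_eqI vimageE)
  qed
  have op: "open (F ` ?B)"
    unfolding image using holomorphic_map_on_imp_continuous_on[OF holG] \<open>open W\<close>
    by (intro continuous_open_preimage) auto
  have "holomorphic_map_on G (F ` ?B)"
    using holG op image unfolding holomorphic_map_on_def by blast
  then have "holomorphic_map_on (inv_into ?B F) (F ` ?B)"
    by (rule holomorphic_map_on_cong) (use GF inj in auto)
  moreover have "holomorphic_map_on F ?B"
    unfolding F_def by (rule holomorphic_map_on_scaleC[OF holf])
  ultimately show "biholomorphic_on F ?B"
    using inj op by (simp add: biholomorphic_on_def)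
qed

theorem theorem3p7:
  assumes nontrivial: "\<exists>x::'a::complex_banach. x \<noteq> 0"
  shows "(\<forall>(F::'a \<Rightarrow> 'a) (f::'a \<Rightarrow> complex).
            biholomorphic_on F (ball 0 1) \<and> holomorphic_map_on f (ball 0 1) \<and> f 0 = 1 \<and>
            (\<forall>x\<in>ball 0 1. F x = f x *\<^sub>C x)
            \<longrightarrow> {x. norm x < 1/4} \<subseteq> F ` ball 0 1)
       \<and> (\<forall>c::real. c > 1/4 \<longrightarrow>
            (\<exists>(F::'a \<Rightarrow> 'a) (f::'a \<Rightarrow> complex).
              biholomorphic_on F (ball 0 1) \<and> holomorphic_map_on f (ball 0 1) \<and> f 0 = 1 \<and>
              (\<forall>x\<in>ball 0 1. F x = f x *\<^sub>C x) \<and>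
              \<not> {x. norm x < c} \<subseteq> F ` ball 0 1))"
proof (intro conjI allI impI)
  fix F :: "'a \<Rightarrow> 'a" and f :: "'a \<Rightarrow> complex"
  assume "biholomorphic_on F (ball 0 1) \<and> holomorphic_map_on f (ball 0 1) \<and> f 0 = 1 \<and>
            (\<forall>x\<in>ball 0 1. F x = f x *\<^sub>C x)"
  then show "{x. norm x < 1/4} \<subseteq> F ` ball 0 1"
    using quarter_ball_subset_image[of F f] by (auto simp: biholomorphic_on_def)
next
  fix c :: real assume "c > 1/4"
  obtain x :: 'a where "x \<noteq> 0" using nontrivial by blast
  define u where "u = sgn x"
  have "norm u = 1" using \<open>x \<noteq> 0\<close> by (simp add: u_def norm_sgn)
  then obtain l :: "'a \<Rightarrow> complex" where l: "bounded_linear l" "\<And>a x. l (a *\<^sub>C x) = a * l x"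
    "l u = 1" "\<And>x. cmod (l x) \<le> norm x"
    using complex_norming_functional by blast
  let ?f = "\<lambda>x. 1 / (1 - l x)\<^sup>2"
  note K = Koebe_map_biholomorphic[OF l(1,2,4)]
  \<comment> \<open>The functional takes the value -1/4 here, which it takes nowhere on the image,
    while the norm is only 1/4.\<close>
  let ?w = "(- (1/4)) *\<^sub>C u"
  have "l ?w = - (1/4)" by (simp only: l(2,3) mult_1_right)
  then have "?w \<notin> (\<lambda>x. ?f x *\<^sub>C x) ` ball 0 1" using K(3) by blast
  moreover have "norm ?w < c" using \<open>norm u = 1\<close> \<open>c > 1/4\<close> by (simp add: norm_scaleC)
  ultimately have "\<not> {x. norm x < c} \<subseteq> (\<lambda>x. ?f x *\<^sub>C x) ` ball 0 1" by blast
  moreover have "?f 0 = 1"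
    using linear_0[OF bounded_linear.linear[OF l(1)]] by simp
  ultimately show "\<exists>(F::'a \<Rightarrow> 'a) (f::'a \<Rightarrow> complex). biholomorphic_on F (ball 0 1) \<and> holomorphic_map_on f (ball 0 1) \<and> f 0 = 1 \<and>
              (\<forall>x\<in>ball 0 1. F x = f x *\<^sub>C x) \<and> \<not> {x. norm x < c} \<subseteq> F ` ball 0 1"
    using K(1,2) by (intro exI[of _ "\<lambda>x. ?f x *\<^sub>C x"] exI[of _ ?f]) blast
qed

end
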